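(* Let $D(x)=1-39x-117x^2+27x^3$ and define integer sequences by the formal power series expansions \[ \frac{4-24x+36x^2}{D(x)}=\sum_{n\ge0}a_nx^n,\ \frac{3-27x^2}{D(x)}=\sum_{n\ge0}b_nx^n,\ \frac{4-36x^2}{D(x)}=\sum_{n\ge0}c_nx^n, \] \[ \frac{2+60x+18x^2}{D(x)}=\sum_{n\ge0}d_nx^n,\ \frac{5-45x^2}{D(x)}=\sum_{n\ge0}e_nx^n. \] Then for all $n\ge0$, $a_n^4+b_n^4+c_n^4+d_n^4=e_n^4-\big(2\cdot(-3)^n\big)^4$. *)

theory Defs
  imports "HOL-Computational_Algebra.Formal_Power_Series"
begin

text \<open>
  The power series live over the rationals because the library has no division of formal
  power series over the integers.  That the coefficients of the quotients by \<open>D\<close> are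
  integers is therefore something to be proved.
\<close>

definition D :: "rat fps" where
  "D = 1 - 39 * fps_X - 117 * fps_X ^ 2 + 27 * fps_X ^ 3"

end

theory Submission
  imports Defs
begin

text \<open>
  Since \<open>D = (1 + 3x)(1 - 42x + 9x\<^sup>2)\<close>, the five sequences are \<open>a = t + q\<close>, \<open>d = t - q\<close>,
  \<open>b = 3s\<close>, \<open>c = 4s\<close>, \<open>e = 5s\<close>, where \<open>q\<^sub>n = (-3)\<^sup>n\<close> and \<open>s\<close>, \<open>t\<close> have the generating
  functions \<open>(1 - 3x)/(1 - 42x + 9x\<^sup>2)\<close> and \<open>3(1 + 3x)/(1 - 42x + 9x\<^sup>2)\<close>.  The claim becomes
  \<open>(t + q)\<^sup>4 + (t - q)\<^sup>4 + (2q)\<^sup>4 = 288s\<^sup>4\<close>.  The left side is \<open>2(t\<^sup>2 + 3q\<^sup>2)\<^sup>2\<close>, and the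
  pair \<open>(s, t)\<close> evolves by a linear map that multiplies the form \<open>12s\<^sup>2 - t\<^sup>2\<close> by 9, so that
  \<open>12s\<^sup>2 - t\<^sup>2 = 3q\<^sup>2\<close> for all \<open>n\<close>.
\<close>

text \<open>One step multiplies \<open>t + s * sqrt 12\<close> by \<open>21 + 6 * sqrt 12\<close>,
  which has trace 42 and norm 9; hence the factor \<open>1 - 42x + 9x^2\<close> of the
  denominator.\<close>

fun st :: "nat \<Rightarrow> rat \<times> rat" where
  "st 0 = (1, 3)"
| "st (Suc n) = (case st n of (s, t) \<Rightarrow> (21 * s + 6 * t, 72 * s + 21 * t))"

definition s :: "nat \<Rightarrow> rat" where "s n = fst (st n)"
definition t :: "nat \<Rightarrow> rat" where "t n = snd (st n)"

lemma s_simps [simp]: "s 0 = 1" "s (Suc n) = 21 * s n + 6 * t n"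
  and t_simps [simp]: "t 0 = 3" "t (Suc n) = 72 * s n + 21 * t n"
  by (simp_all add: s_def t_def split: prod.split)

lemma s_t_Ints: "s n \<in> \<int> \<and> t n \<in> \<int>"
  by (induction n) auto

lemma norm_s_t: "12 * s n ^ 2 = t n ^ 2 + 3 * ((-3) ^ n) ^ 2"
  by (induction n) (simp_all add: power2_eq_square algebra_simps)

text \<open>The multiples 3, 4, 5 fit because 5^4 - 3^4 - 4^4 = 288 = 2 * 12^2.\<close>

lemma quartic_identity:
  fixes x y q :: "'a::idom"
  assumes "12 * y ^ 2 = x ^ 2 + 3 * q ^ 2"
  shows "(x + q) ^ 4 + (3 * y) ^ 4 + (4 * y) ^ 4 + (x - q) ^ 4 = (5 * y) ^ 4 - (2 * q) ^ 4"
proof -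
  have "(x + q) ^ 4 + (x - q) ^ 4 + (2 * q) ^ 4 = 2 * (x ^ 2 + 3 * q ^ 2) ^ 2"
    by algebra
  also have "\<dots> = 288 * y ^ 4"
    unfolding assms[symmetric] by algebra
  finally show ?thesis
    by algebra
qed

text \<open>Turns a recurrence into a linear equation between generating functions.\<close>

lemma Abs_fps_unfold:
  fixes f :: "nat \<Rightarrow> 'a::comm_ring_1"
  shows "Abs_fps f = fps_const (f 0) + fps_X * Abs_fps (\<lambda>n. f (Suc n))"
  by (rule fps_ext) (auto simp: fps_X_mult_nth split: nat.splits)

lemma Abs_fps_s_unfold: "Abs_fps s = 1 + fps_X * (21 * Abs_fps s + 6 * Abs_fps t)"
proof -
  have "Abs_fps (\<lambda>n. s (Suc n)) = 21 * Abs_fps s + 6 * Abs_fps t"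
    by (rule fps_ext) (simp add: numeral_fps_const)
  then show ?thesis
    using Abs_fps_unfold[of s] by simp
qed

lemma Abs_fps_t_unfold: "Abs_fps t = 3 + fps_X * (72 * Abs_fps s + 21 * Abs_fps t)"
proof -
  have "Abs_fps (\<lambda>n. t (Suc n)) = 72 * Abs_fps s + 21 * Abs_fps t"
    by (rule fps_ext) (simp add: numeral_fps_const)
  then show ?thesis
    using Abs_fps_unfold[of t] by (simp add: numeral_fps_const)
qed

lemma Abs_fps_power_unfold: "Abs_fps ((^) (-3 :: rat)) = 1 - 3 * fps_X * Abs_fps ((^) (-3))"
proof -
  have "Abs_fps (\<lambda>n. (-3 :: rat) ^ Suc n) = - 3 * Abs_fps ((^) (-3))"
    by (rule fps_ext) (simp add: numeral_fps_const)
  with Abs_fps_unfold[of "(^) (-3 :: rat)"] show ?thesis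
    by (simp only: power_0 fps_const_1_eq_1) algebra
qed

lemma D_factor: "D = (1 + 3 * fps_X) * (1 - 42 * fps_X + 9 * fps_X ^ 2)"
  unfolding D_def by algebra

lemma D_mult_s: "D * Abs_fps s = (1 - 3 * fps_X) * (1 + 3 * fps_X)"
proof -
  \<comment> \<open>Eliminating \<open>Abs_fps t\<close> from the two linear equations leaves their
    determinant (1 - 21x)^2 - 432x^2 as the factor.\<close>
  have "(1 - 42 * fps_X + 9 * fps_X ^ 2) * Abs_fps s = 1 - 3 * fps_X"
    using Abs_fps_s_unfold Abs_fps_t_unfold by algebra
  then show ?thesis
    unfolding D_factor by algebra
qed

lemma D_mult_t: "D * Abs_fps t = 3 * (1 + 3 * fps_X) ^ 2"
proof -
  have "(1 - 42 * fps_X + 9 * fps_X ^ 2) * Abs_fps t = 3 * (1 + 3 * fps_X)"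
    using Abs_fps_s_unfold Abs_fps_t_unfold by algebra
  then show ?thesis
    unfolding D_factor by algebra
qed

lemma D_mult_power: "D * Abs_fps ((^) (-3)) = 1 - 42 * fps_X + 9 * fps_X ^ 2"
  unfolding D_factor using Abs_fps_power_unfold by algebra

text \<open>Reduces each expansion to a product identity: power series over a field form a domain,
  so \<open>D\<close> cancels.\<close>

lemma coeff_of_quotient_by_D:
  assumes "N / D = Abs_fps f" and "N = D * g"
  shows "f n = fps_nth g n"
proof -
  have "fps_nth D 0 = 1"
    by (simp add: D_def)
  then have "D \<noteq> 0"
    by auto
  with assms have "Abs_fps f = g"
    by (metis nonzero_mult_div_cancel_left)
  then show ?thesis
    by (metis fps_nth_Abs_fps)
qed

theorem theorem2p9:
  fixes a b c d e :: "nat \<Rightarrow> rat"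
  assumes "(4 - 24 * fps_X + 36 * fps_X ^ 2) / D = Abs_fps a"
    and "(3 - 27 * fps_X ^ 2) / D = Abs_fps b"
    and "(4 - 36 * fps_X ^ 2) / D = Abs_fps c"
    and "(2 + 60 * fps_X + 18 * fps_X ^ 2) / D = Abs_fps d"
    and "(5 - 45 * fps_X ^ 2) / D = Abs_fps e"
  shows "(\<forall>n. a n \<in> \<int> \<and> b n \<in> \<int> \<and> c n \<in> \<int> \<and> d n \<in> \<int> \<and> e n \<in> \<int>) \<and>
    (\<forall>n. a n ^ 4 + b n ^ 4 + c n ^ 4 + d n ^ 4 = e n ^ 4 - (2 * (-3) ^ n) ^ 4)"
proof -
  let ?S = "Abs_fps s" and ?T = "Abs_fps t" and ?Q = "Abs_fps ((^) (-3 :: rat))"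
  \<comment> \<open>The numerators for \<open>a\<close> and \<open>d\<close> are 3(1 + 3x)^2 plus
    and minus (1 - 42x + 9x^2); those for \<open>b\<close>, \<open>c\<close>, \<open>e\<close> are
    multiples of 1 - 9x^2.\<close>
  have "4 - 24 * fps_X + 36 * fps_X ^ 2 = D * (?T + ?Q)"
    using D_mult_t D_mult_power by algebra
  from coeff_of_quotient_by_D[OF assms(1) this]
  have a: "a n = t n + (-3) ^ n" for n
    by simp
  have "3 - 27 * fps_X ^ 2 = D * (3 * ?S)"
    using D_mult_s by algebra
  from coeff_of_quotient_by_D[OF assms(2) this]
  have b: "b n = 3 * s n" for n
    by (simp add: numeral_fps_const)
  have "4 - 36 * fps_X ^ 2 = D * (4 * ?S)"
    using D_mult_s by algebra
  from coeff_of_quotient_by_D[OF assms(3) this]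
  have c: "c n = 4 * s n" for n
    by (simp add: numeral_fps_const)
  have "2 + 60 * fps_X + 18 * fps_X ^ 2 = D * (?T - ?Q)"
    using D_mult_t D_mult_power by algebra
  from coeff_of_quotient_by_D[OF assms(4) this]
  have d: "d n = t n - (-3) ^ n" for n
    by simp
  have "5 - 45 * fps_X ^ 2 = D * (5 * ?S)"
    using D_mult_s by algebra
  from coeff_of_quotient_by_D[OF assms(5) this]
  have e: "e n = 5 * s n" for n
    by (simp add: numeral_fps_const)
  have "a n ^ 4 + b n ^ 4 + c n ^ 4 + d n ^ 4 = e n ^ 4 - (2 * (-3) ^ n) ^ 4" for n
    unfolding a b c d e by (rule quartic_identity) (rule norm_s_t)
  moreover have "a n \<in> \<int> \<and> b n \<in> \<int> \<and> c n \<in> \<int> \<and> d n \<in> \<int> \<and> e n \<in> \<int>" for n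
    unfolding a b c d e using s_t_Ints[of n] by auto
  ultimately show ?thesis
    by blast
qed

end
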